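(* Let $f:A\to B$ be a monoid homomorphism. Then $f$ is a regular Schreier epimorphism if and only if there exist a monoid $C$ and a monoid homomorphism $g:C\to A$ such that $(f,g)$ is a Schreier generalized point.
   Context: Monoids (not necessarily commutative) are written additively, and $\mathrm{Ker}(f)=\{a\in A\mid f(a)=0\}$. Let $f:A\to B$ be a surjective monoid homomorphism. An element $a\in A$ is a representative of an element $b\in B$ if $f(a)=b$ and for every $a'\in A$ with $f(a')=b$ there exists a unique $k\in\mathrm{Ker}(f)$ with $a'=k+a$. The homomorphism $f$ is a Schreier epimorphism if every element of $B$ has a representative. It is a regular Schreier epimorphism if it is a Schreier epimorphism and the set of all representatives of elements of $B$ is a submonoid of $A$. (Thus a regular Schreier epimorphism is in particular surjective.) A pair $(f:A\to B,\ g:C\to A)$ of monoid homomorphisms is a generalized point if $fg:C\to B$ is surjective. It is a Schreier generalized point if, moreover, for every $a\in A$ and every $c\in C$ with $f(a)=fg(c)$ there exists a unique $k\in\mathrm{Ker}(f)$ such that $a=k+g(c)$. *)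

theory Defs
  imports "HOL-Algebra.Coset"
begin

text \<open>
  Monoids are the not necessarily commutative monoids of HOL-Algebra, in multiplicative notation:
  the sum \<open>k + a\<close> is \<open>k \<otimes> a\<close> and \<open>0\<close> is \<open>\<one>\<close>. Preservation of the unit has to be demanded
  separately, since \<^const>\<open>hom\<close> only requires preservation of the multiplication.
\<close>

definition mhom :: "('a, 'm) monoid_scheme \<Rightarrow> ('b, 'n) monoid_scheme \<Rightarrow> ('a \<Rightarrow> 'b) set" where
  "mhom A B = {f \<in> hom A B. f \<one>\<^bsub>A\<^esub> = \<one>\<^bsub>B\<^esub>}"

definition is_representative ::
  "('a, 'm) monoid_scheme \<Rightarrow> ('b, 'n) monoid_scheme \<Rightarrow> ('a \<Rightarrow> 'b) \<Rightarrow> 'a \<Rightarrow> 'b \<Rightarrow> bool" where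
  "is_representative A B f a b \<longleftrightarrow>
     a \<in> carrier A \<and> b \<in> carrier B \<and> f a = b \<and>
     (\<forall>a' \<in> carrier A. f a' = b \<longrightarrow> (\<exists>!k. k \<in> kernel A B f \<and> a' = k \<otimes>\<^bsub>A\<^esub> a))"

definition schreier_epi ::
  "('a, 'm) monoid_scheme \<Rightarrow> ('b, 'n) monoid_scheme \<Rightarrow> ('a \<Rightarrow> 'b) \<Rightarrow> bool" where
  "schreier_epi A B f \<longleftrightarrow>
     f \<in> mhom A B \<and> f ` carrier A = carrier B \<and>
     (\<forall>b \<in> carrier B. \<exists>a. is_representative A B f a b)"

definition regular_schreier_epi ::
  "('a, 'm) monoid_scheme \<Rightarrow> ('b, 'n) monoid_scheme \<Rightarrow> ('a \<Rightarrow> 'b) \<Rightarrow> bool" where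
  "regular_schreier_epi A B f \<longleftrightarrow>
     schreier_epi A B f \<and>
     submonoid {a. \<exists>b \<in> carrier B. is_representative A B f a b} A"

definition generalized_point ::
  "('a, 'm) monoid_scheme \<Rightarrow> ('b, 'n) monoid_scheme \<Rightarrow> ('c, 'l) monoid_scheme \<Rightarrow>
   ('a \<Rightarrow> 'b) \<Rightarrow> ('c \<Rightarrow> 'a) \<Rightarrow> bool" where
  "generalized_point A B C f g \<longleftrightarrow>
     f \<in> mhom A B \<and> g \<in> mhom C A \<and> (f \<circ> g) ` carrier C = carrier B"

definition schreier_generalized_point ::
  "('a, 'm) monoid_scheme \<Rightarrow> ('b, 'n) monoid_scheme \<Rightarrow> ('c, 'l) monoid_scheme \<Rightarrow>
   ('a \<Rightarrow> 'b) \<Rightarrow> ('c \<Rightarrow> 'a) \<Rightarrow> bool" where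
  "schreier_generalized_point A B C f g \<longleftrightarrow>
     generalized_point A B C f g \<and>
     (\<forall>a \<in> carrier A. \<forall>c \<in> carrier C. f a = f (g c) \<longrightarrow>
        (\<exists>!k. k \<in> kernel A B f \<and> a = k \<otimes>\<^bsub>A\<^esub> g c))"

end

(* Two representatives of the same element differ by a left factor that is a unit of the kernel, and
   conversely such a factor turns representatives into representatives.  For a Schreier generalized
   point (f, g) every g c represents f (g c), so each representative has the form u * g c with u a
   unit of the kernel.  Pushing a unit u of the kernel past g c yields g c * u = m * g c with m again
   a unit of the kernel, so u1 * g c1 * u2 * g c2 = (u1 * m) * g (c1 * c2) is a representative.
   In the other direction, C is the submonoid of representatives and g its inclusion. *)
theory Submission
  imports Defs
begin

locale monoid_hom = A: monoid A + B: monoid B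
  for A :: "('a, 'm) monoid_scheme" (structure) and B :: "('b, 'n) monoid_scheme" +
  fixes f :: "'a \<Rightarrow> 'b"
  assumes mhom: "f \<in> mhom A B"
begin

lemma
  shows f_closed: "x \<in> carrier A \<Longrightarrow> f x \<in> carrier B"
    and f_mult: "\<lbrakk>x \<in> carrier A; y \<in> carrier A\<rbrakk> \<Longrightarrow> f (x \<otimes> y) = f x \<otimes>\<^bsub>B\<^esub> f y"
    and f_one: "f \<one> = \<one>\<^bsub>B\<^esub>"
  using mhom by (auto simp: mhom_def hom_def)

lemma kernel_iff: "k \<in> kernel A B f \<longleftrightarrow> k \<in> carrier A \<and> f k = \<one>\<^bsub>B\<^esub>"
  by (simp add: kernel_def)

lemma kernel_mult: "\<lbrakk>k \<in> kernel A B f; l \<in> kernel A B f\<rbrakk> \<Longrightarrow> k \<otimes> l \<in> kernel A B f"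
  by (simp add: kernel_iff f_mult)

lemma kernel_one: "\<one> \<in> kernel A B f"
  by (simp add: kernel_iff f_one)

lemma is_representativeD:
  assumes "is_representative A B f r b"
  shows "r \<in> carrier A" and "b \<in> carrier B" and "f r = b"
  using assms by (auto simp: is_representative_def)

lemma representative_decompose:
  assumes "is_representative A B f r b" and "a \<in> carrier A" and "f a = b"
  obtains k where "k \<in> kernel A B f" and "a = k \<otimes> r"
  using assms unfolding is_representative_def by blast

text \<open>\<open>k \<otimes> r\<close> itself lies over \<open>b\<close>, because
  \<open>f k\<close> is the unit, so the uniqueness clause of \<open>r\<close> applies to it. This
  is the substitute for right cancellation, which \<open>A\<close> need not have.\<close>

lemma representative_cancel:
  assumes r: "is_representative A B f r b"
    and k: "k \<in> kernel A B f" and l: "l \<in> kernel A B f"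
    and eq: "k \<otimes> r = l \<otimes> r"
  shows "k = l"
proof -
  have "k \<otimes> r \<in> carrier A" and "f (k \<otimes> r) = b"
    using is_representativeD[OF r] k by (auto simp: kernel_iff f_mult)
  then have "\<exists>!m. m \<in> kernel A B f \<and> k \<otimes> r = m \<otimes> r"
    using r unfolding is_representative_def by blast
  then show ?thesis using k l eq by blast
qed

lemma representative_one:
  assumes "is_representative A B f r b" and "k \<in> kernel A B f" and "k \<otimes> r = r"
  shows "k = \<one>"
  using representative_cancel[OF assms(1,2) kernel_one] assms is_representativeD by simp

text \<open>Since \<open>u\<close> and \<open>v\<close> are mutually inverse,
  \<open>l \<mapsto> l \<otimes> u\<close> and \<open>k \<mapsto> k \<otimes> v\<close> match the
  kernel factors of \<open>a\<close> relative to \<open>u \<otimes> r\<close> with those relative to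
  \<open>r\<close>. Existence and uniqueness carry over.\<close>

lemma representative_unit_mult:
  assumes r: "is_representative A B f r b"
    and u: "u \<in> kernel A B f" and v: "v \<in> kernel A B f"
    and uv: "u \<otimes> v = \<one>" and vu: "v \<otimes> u = \<one>"
  shows "is_representative A B f (u \<otimes> r) b"
proof -
  note rD = is_representativeD[OF r]
  have uA: "u \<in> carrier A" and vA: "v \<in> carrier A"
    using u v by (auto simp: kernel_iff)
  have "\<exists>!k. k \<in> kernel A B f \<and> a = k \<otimes> (u \<otimes> r)" if a: "a \<in> carrier A" "f a = b" for a
  proof -
    obtain k where k: "k \<in> kernel A B f" "a = k \<otimes> r"
      using representative_decompose[OF r a] .
    have kA: "k \<in> carrier A" using k by (simp add: kernel_iff)
    show ?thesis
    proof (rule ex1I[of _ "k \<otimes> v"])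
      have "(k \<otimes> v) \<otimes> (u \<otimes> r) = k \<otimes> (v \<otimes> u) \<otimes> r"
        using kA uA vA rD by (simp add: A.m_assoc)
      then show "k \<otimes> v \<in> kernel A B f \<and> a = (k \<otimes> v) \<otimes> (u \<otimes> r)"
        using k kA vu v kernel_mult by simp
    next
      fix l assume l: "l \<in> kernel A B f \<and> a = l \<otimes> (u \<otimes> r)"
      then have lA: "l \<in> carrier A" by (simp add: kernel_iff)
      have "(l \<otimes> u) \<otimes> r = k \<otimes> r"
        using l k lA uA rD by (simp add: A.m_assoc)
      then have "l \<otimes> u = k"
        using representative_cancel[OF r] l k u kernel_mult by blast
      then have "k \<otimes> v = l \<otimes> (u \<otimes> v)"
        using lA uA vA by (simp add: A.m_assoc[symmetric])
      then show "l = k \<otimes> v" using uv lA by simp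
    qed
  qed
  moreover have "f (u \<otimes> r) = b" using u rD by (simp add: kernel_iff f_mult)
  ultimately show ?thesis
    using rD uA by (simp add: is_representative_def)
qed

text \<open>Each representative factors through the other by a kernel element. Composing the two
  factorizations fixes \<open>r\<close> and \<open>s\<close>, and a kernel element fixing a
  representative is the unit.\<close>

lemma representatives_differ_by_unit:
  assumes r: "is_representative A B f r b" and s: "is_representative A B f s b"
  obtains u v where "u \<in> kernel A B f" "v \<in> kernel A B f" "u \<otimes> v = \<one>" "v \<otimes> u = \<one>" "s = u \<otimes> r"
proof -
  note rD = is_representativeD[OF r] and sD = is_representativeD[OF s]
  obtain u where u: "u \<in> kernel A B f" "s = u \<otimes> r"
    using representative_decompose[OF r sD(1,3)] .
  obtain v where v: "v \<in> kernel A B f" "r = v \<otimes> s"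
    using representative_decompose[OF s rD(1,3)] .
  have uA: "u \<in> carrier A" and vA: "v \<in> carrier A"
    using u v by (auto simp: kernel_iff)
  \<comment> \<open>After reassociation, \<open>v \<otimes> s\<close> folds to \<open>r\<close> and
    \<open>u \<otimes> r\<close> to \<open>s\<close>. The two equations are flipped because read
    left to right they would rewrite into each other forever.\<close>
  have "(u \<otimes> v) \<otimes> s = s" "(v \<otimes> u) \<otimes> r = r"
    using A.m_assoc[OF uA vA sD(1)] A.m_assoc[OF vA uA rD(1)] by (simp_all flip: u(2) v(2))
  then have "u \<otimes> v = \<one>" "v \<otimes> u = \<one>"
    using representative_one[OF s] representative_one[OF r] kernel_mult u(1) v(1) by blast+
  then show thesis using that u v by blast
qed

text \<open>Both \<open>r \<otimes> u\<close> and \<open>r \<otimes> v\<close> still lie over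
  \<open>b\<close>, so both factor through \<open>r\<close>. The left factors \<open>m\<close> and
  \<open>n\<close> inherit the inverse relations of \<open>u\<close> and \<open>v\<close>.\<close>

lemma kernel_unit_past_representative:
  assumes r: "is_representative A B f r b"
    and u: "u \<in> kernel A B f" and v: "v \<in> kernel A B f"
    and uv: "u \<otimes> v = \<one>" and vu: "v \<otimes> u = \<one>"
  obtains m n where "m \<in> kernel A B f" "n \<in> kernel A B f" "m \<otimes> n = \<one>" "n \<otimes> m = \<one>"
    "r \<otimes> u = m \<otimes> r"
proof -
  note rD = is_representativeD[OF r]
  have uA: "u \<in> carrier A" and vA: "v \<in> carrier A"
    using u v by (auto simp: kernel_iff)
  have "f (r \<otimes> u) = b" "f (r \<otimes> v) = b"
    using rD u v by (auto simp: kernel_iff f_mult)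
  then obtain m n where m: "m \<in> kernel A B f" "r \<otimes> u = m \<otimes> r"
    and n: "n \<in> kernel A B f" "r \<otimes> v = n \<otimes> r"
    using representative_decompose[OF r A.m_closed[OF rD(1) uA] \<open>f (r \<otimes> u) = b\<close>]
      representative_decompose[OF r A.m_closed[OF rD(1) vA] \<open>f (r \<otimes> v) = b\<close>] by metis
  have mA: "m \<in> carrier A" and nA: "n \<in> carrier A"
    using m n by (auto simp: kernel_iff)
  \<comment> \<open>Trading \<open>n\<close> and then \<open>m\<close> back across \<open>r\<close>
    turns the product into \<open>r \<otimes> (u \<otimes> v)\<close>, which is
    \<open>r\<close>.\<close>
  have "(m \<otimes> n) \<otimes> r = m \<otimes> (r \<otimes> v)" using mA nA rD n by (simp add: A.m_assoc)
  also have "\<dots> = (r \<otimes> u) \<otimes> v" using mA vA rD m by (simp add: A.m_assoc)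
  also have "\<dots> = r" using uA vA rD uv by (simp add: A.m_assoc)
  finally have mn: "m \<otimes> n = \<one>" using representative_one[OF r] m n kernel_mult by blast
  have "(n \<otimes> m) \<otimes> r = n \<otimes> (r \<otimes> u)" using mA nA rD m by (simp add: A.m_assoc)
  also have "\<dots> = (r \<otimes> v) \<otimes> u" using nA uA rD n by (simp add: A.m_assoc)
  also have "\<dots> = r" using uA vA rD vu by (simp add: A.m_assoc)
  finally have "n \<otimes> m = \<one>" using representative_one[OF r] m n kernel_mult by blast
  with mn m n show thesis using that by blast
qed

text \<open>The units by which \<open>s1\<close> and \<open>s2\<close> differ from \<open>r1\<close>
  and \<open>r2\<close> gather to the left of \<open>r1 \<otimes> r2\<close> into a single unit.
  Hence one good pair over \<open>b1\<close> and \<open>b2\<close> settles all pairs.\<close>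

lemma representative_mult:
  assumes r1: "is_representative A B f r1 b1" and r2: "is_representative A B f r2 b2"
    and r12: "is_representative A B f (r1 \<otimes> r2) (b1 \<otimes>\<^bsub>B\<^esub> b2)"
    and s1: "is_representative A B f s1 b1" and s2: "is_representative A B f s2 b2"
  shows "is_representative A B f (s1 \<otimes> s2) (b1 \<otimes>\<^bsub>B\<^esub> b2)"
proof -
  obtain u1 v1 where 1: "u1 \<in> kernel A B f" "v1 \<in> kernel A B f" "u1 \<otimes> v1 = \<one>" "v1 \<otimes> u1 = \<one>"
    and s1_eq: "s1 = u1 \<otimes> r1"
    using representatives_differ_by_unit[OF r1 s1] .
  obtain u2 v2 where 2: "u2 \<in> kernel A B f" "v2 \<in> kernel A B f" "u2 \<otimes> v2 = \<one>" "v2 \<otimes> u2 = \<one>"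
    and s2_eq: "s2 = u2 \<otimes> r2"
    using representatives_differ_by_unit[OF r2 s2] .
  obtain m n where m: "m \<in> kernel A B f" "n \<in> kernel A B f" "m \<otimes> n = \<one>" "n \<otimes> m = \<one>"
    and past: "r1 \<otimes> u2 = m \<otimes> r1"
    using kernel_unit_past_representative[OF r1 2] .
  note carr = is_representativeD(1)[OF r1] is_representativeD(1)[OF r2]
  have [simp]: "u1 \<in> carrier A" "v1 \<in> carrier A" "u2 \<in> carrier A" "m \<in> carrier A" "n \<in> carrier A"
    using 1 2 m by (auto simp: kernel_iff)
  have "s1 \<otimes> s2 = u1 \<otimes> (r1 \<otimes> u2) \<otimes> r2"
    using carr by (simp add: s1_eq s2_eq A.m_assoc)
  also have "\<dots> = (u1 \<otimes> m) \<otimes> (r1 \<otimes> r2)"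
    using carr by (simp add: past A.m_assoc)
  finally have eq: "s1 \<otimes> s2 = (u1 \<otimes> m) \<otimes> (r1 \<otimes> r2)" .
  \<comment> \<open>\<open>n \<otimes> v1\<close> serves as the two-sided inverse of
    \<open>u1 \<otimes> m\<close> within the kernel.\<close>
  have "(u1 \<otimes> m) \<otimes> (n \<otimes> v1) = u1 \<otimes> (m \<otimes> n) \<otimes> v1"
    by (simp add: A.m_assoc)
  then have "(u1 \<otimes> m) \<otimes> (n \<otimes> v1) = \<one>" using 1 m by simp
  moreover have "(n \<otimes> v1) \<otimes> (u1 \<otimes> m) = n \<otimes> (v1 \<otimes> u1) \<otimes> m"
    by (simp add: A.m_assoc)
  then have "(n \<otimes> v1) \<otimes> (u1 \<otimes> m) = \<one>" using 1 m by simp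
  ultimately show ?thesis
    unfolding eq using representative_unit_mult[OF r12] kernel_mult 1 m by blast
qed

lemma schreier_generalized_point_imp_regular:
  assumes C: "monoid C" and pt: "schreier_generalized_point A B C f g"
  shows "regular_schreier_epi A B f"
proof -
  have g: "g \<in> hom C A" "g \<one>\<^bsub>C\<^esub> = \<one>" and surj: "(\<lambda>c. f (g c)) ` carrier C = carrier B"
    using pt
    by (auto simp: schreier_generalized_point_def generalized_point_def mhom_def image_comp[symmetric]
        image_image)
  have gA: "g c \<in> carrier A" if "c \<in> carrier C" for c
    using g that by (auto simp: hom_def)
  \<comment> \<open>The Schreier condition at a fixed \<open>c\<close> is the factorization clause
    for \<open>g c\<close> over \<open>f (g c)\<close>.\<close>
  have rep: "is_representative A B f (g c) (f (g c))" if "c \<in> carrier C" for c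
    using pt that gA f_closed by (simp add: is_representative_def schreier_generalized_point_def)
  have ex: "\<exists>c \<in> carrier C. b = f (g c)" if "b \<in> carrier B" for b
    using surj that by blast
  have "f ` carrier A = carrier B"
    using ex gA f_closed by blast
  then have "schreier_epi A B f"
    unfolding schreier_epi_def using mhom ex rep by blast
  moreover have "submonoid {a. \<exists>b \<in> carrier B. is_representative A B f a b} A"
  proof
    show "{a. \<exists>b \<in> carrier B. is_representative A B f a b} \<subseteq> carrier A"
      using is_representativeD by auto
  next
    have "is_representative A B f \<one> \<one>\<^bsub>B\<^esub>"
      using rep[OF monoid.one_closed[OF C]] by (simp add: g f_one)
    then show "\<one> \<in> {a. \<exists>b \<in> carrier B. is_representative A B f a b}" by auto
  next
    fix s1 s2
    assume "s1 \<in> {a. \<exists>b \<in> carrier B. is_representative A B f a b}"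
      and "s2 \<in> {a. \<exists>b \<in> carrier B. is_representative A B f a b}"
    \<comment> \<open>Surjectivity of \<open>f \<circ> g\<close> supplies \<open>g c1\<close> and
      \<open>g c2\<close> as reference representatives of the same elements. Their product is
      \<open>g\<close> of a product, hence again a representative.\<close>
    then obtain c1 c2 where c: "c1 \<in> carrier C" "c2 \<in> carrier C"
      and s: "is_representative A B f s1 (f (g c1))" "is_representative A B f s2 (f (g c2))"
      using ex by blast
    have "g (c1 \<otimes>\<^bsub>C\<^esub> c2) = g c1 \<otimes> g c2" using g c by (simp add: hom_def)
    then have "is_representative A B f (g c1 \<otimes> g c2) (f (g c1) \<otimes>\<^bsub>B\<^esub> f (g c2))"
      using rep[OF monoid.m_closed[OF C c]] c gA f_mult by simp
    then have "is_representative A B f (s1 \<otimes> s2) (f (g c1) \<otimes>\<^bsub>B\<^esub> f (g c2))"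
      using representative_mult rep c s by blast
    then show "s1 \<otimes> s2 \<in> {a. \<exists>b \<in> carrier B. is_representative A B f a b}"
      using is_representativeD(2) by blast
  qed
  ultimately show ?thesis by (simp add: regular_schreier_epi_def)
qed

lemma regular_imp_schreier_generalized_point:
  assumes reg: "regular_schreier_epi A B f"
  obtains C :: "'a monoid" and g where "monoid C" "g \<in> mhom C A" "schreier_generalized_point A B C f g"
proof -
  define S where "S = {a. \<exists>b \<in> carrier B. is_representative A B f a b}"
  \<comment> \<open>A new record is built, rather than \<open>A\<close> with its carrier replaced,
    because \<open>A\<close> may have further fields and \<open>C\<close> must be a plain monoid
    record.\<close>
  define C :: "'a monoid" where "C = \<lparr>carrier = S, mult = (\<otimes>), one = \<one>\<rparr>"
  have sub: "submonoid S A" and epi: "schreier_epi A B f"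
    using reg by (auto simp: regular_schreier_epi_def S_def)
  interpret S: submonoid S A by (fact sub)
  have SA: "s \<in> carrier A" if "s \<in> S" for s
    using S.subset that by blast
  have "monoid C"
    by (rule monoidI) (auto simp: C_def SA A.m_assoc S.m_closed S.one_closed)
  moreover have id: "id \<in> mhom C A"
    by (auto simp: mhom_def hom_def C_def SA)
  moreover have "f ` S = carrier B"
  proof
    show "f ` S \<subseteq> carrier B" using SA f_closed by blast
    show "carrier B \<subseteq> f ` S"
    proof
      fix b assume b: "b \<in> carrier B"
      then obtain r where r: "is_representative A B f r b"
        using epi by (auto simp: schreier_epi_def)
      with b have "r \<in> S" by (auto simp: S_def)
      with is_representativeD(3)[OF r] show "b \<in> f ` S" by blast
    qed
  qed
  then have "generalized_point A B C f id"
    using mhom id by (simp add: generalized_point_def C_def)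
  \<comment> \<open>An \<open>s \<in> S\<close> represents some \<open>b\<close>, which can only be
    \<open>f s\<close>.\<close>
  moreover have "\<exists>!k. k \<in> kernel A B f \<and> a = k \<otimes> s" if "a \<in> carrier A" "s \<in> S" "f a = f s" for a s
    using that unfolding S_def is_representative_def by blast
  ultimately show thesis
    using that[of C id] by (simp add: schreier_generalized_point_def C_def)
qed

end

text \<open>HOL cannot quantify over the type of \<open>C\<close> inside a formula. The equivalence
  therefore takes \<open>C\<close> over the element type of \<open>A\<close>, which accommodates the
  submonoid of representatives, and the second conjunct gives the converse for \<open>C\<close> over
  an arbitrary type.\<close>

theorem theorem4:
  fixes A :: "('a, 'm) monoid_scheme" and B :: "('b, 'n) monoid_scheme" and f :: "'a \<Rightarrow> 'b"
  assumes "monoid A" and "monoid B" and "f \<in> mhom A B"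
  shows "(regular_schreier_epi A B f \<longleftrightarrow>
            (\<exists>(C :: 'a monoid) g. monoid C \<and> g \<in> mhom C A \<and> schreier_generalized_point A B C f g)) \<and>
         (\<forall>(C :: ('c, 'l) monoid_scheme) g.
            monoid C \<and> g \<in> mhom C A \<and> schreier_generalized_point A B C f g \<longrightarrow>
            regular_schreier_epi A B f)"
proof -
  interpret monoid_hom A B f
    using assms by (simp add: monoid_hom_def monoid_hom_axioms_def)
  show ?thesis
    using schreier_generalized_point_imp_regular regular_imp_schreier_generalized_point by metis
qed

end
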